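(* There exists $T_0>0$ such that for any $a\in\mathbb{C}$ there exist positive numbers $\sigma_a$ and $\gamma$ such that for every positive integer $N$: (i) all $a$-values of $\zeta_N(s)$ with $t\ge T_0$ lie within the region $|\sigma|<\sigma_aN^{\gamma}$; (ii) if $\sigma\ge\sigma_aN^{\gamma}$ and $t\ge T_0$, then $\zeta_N(s)-a\in D\bigl(a_1-a,\ |a_1-a|/2\bigr)$ when $a\neq a_1$, and $(\zeta_N(s)-a)\lambda_2^s\in D\bigl(a_2,\ |a_2|/2\bigr)$ when $a=a_1$; (iii) if $\sigma\le-\sigma_aN^{\gamma}$ and $t\ge T_0$, then $|\zeta_N(s)-a|>1$.
   Context: Write $s=\sigma+it$ with $\sigma,t\in\mathbb{R}$. Let $F(s)=\sum_{n=1}^\infty a_n\lambda_n^{-s}$ be a general Dirichlet series, absolutely convergent in some half-plane, with $a_n\in\mathbb{C}$, $\lambda_n$ real and strictly increasing, $\lambda_1=1$ (so $\lambda_n\ge1$), $a_2\neq0$, $a_3\ne0$ (possibly $a_1=0$), and $|a_n|$, $\lambda_n$ growing at most polynomially in $n$. Assume $F$ satisfies the functional equation $$\Omega(s)F(s)=\lambda^{2s-\delta}\Omega(\delta-s)F(\delta-s),\qquad \Omega(s)=\prod_{i=1}^k\Gamma(\alpha_is+\beta_i),$$ with $\lambda>0$, $\delta\in\mathbb{R}$, $\alpha_i>0$, $\beta_i\in\mathbb{R}$. Put $$F_N(s)=\sum_{n=1}^N\frac{a_n}{\lambda_n^s},\qquad G(s)=\lambda^{2s-\delta}\frac{\Omega(\delta-s)}{\Omega(s)},\qquad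 \zeta_N(s)=F_N(s)+G(s)F_N(\delta-s).$$ An $a$-value of $\zeta_N$ is a zero of $\zeta_N(s)-a$, counted with multiplicity. $D(c,r)$ denotes the open disc in $\mathbb{C}$ with center $c$ and radius $r$.
   Formalization: For N=1 false cases are excluded: in (ii) the case a=a_1 needs N≥2; (i) omits N=1 with a_1=0, a=0 (ζ_1-a vanishes identically); (iii) omits N=1 with a_1=0, |a|≤1. At least one Gamma factor (k≥1) is assumed. *)

theory Defs
  imports "HOL-Complex_Analysis.Complex_Analysis" "HOL-Library.Landau_Symbols"
begin

text \<open>
  Sequences are indexed from 1, as in the mathematics; the values at index 0 are never used.
  The base of every complex power below is a positive real, so \<open>powr\<close> is the usual real-base
  power \<open>exp (s * ln x)\<close>.
\<close>

definition dirichlet_term :: "(nat \<Rightarrow> complex) \<Rightarrow> (nat \<Rightarrow> real) \<Rightarrow> complex \<Rightarrow> nat \<Rightarrow> complex" where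
  "dirichlet_term a l s n = a n / complex_of_real (l n) powr s"

definition F_trunc :: "(nat \<Rightarrow> complex) \<Rightarrow> (nat \<Rightarrow> real) \<Rightarrow> nat \<Rightarrow> complex \<Rightarrow> complex" where
  "F_trunc a l N s = (\<Sum>n=1..N. dirichlet_term a l s n)"

definition Omega :: "nat \<Rightarrow> (nat \<Rightarrow> real) \<Rightarrow> (nat \<Rightarrow> real) \<Rightarrow> complex \<Rightarrow> complex" where
  "Omega k \<alpha> \<beta> s = (\<Prod>i=1..k. Gamma (complex_of_real (\<alpha> i) * s + complex_of_real (\<beta> i)))"

text \<open>
  \<open>Gamma\<close> is totalised by 0 at its poles and division by \<open>x / 0 = 0\<close>, so \<open>G_factor\<close> may differ
  from the meromorphic quotient at isolated points. With real \<open>\<alpha> i\<close>, \<open>\<beta> i\<close> and \<open>\<delta>\<close> all of these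
  points are real; for \<open>Im s > 0\<close> the values are the true ones.
\<close>

definition G_factor ::
    "real \<Rightarrow> real \<Rightarrow> nat \<Rightarrow> (nat \<Rightarrow> real) \<Rightarrow> (nat \<Rightarrow> real) \<Rightarrow> complex \<Rightarrow> complex" where
  "G_factor L \<delta> k \<alpha> \<beta> s =
     complex_of_real L powr (2 * s - complex_of_real \<delta>) *
     Omega k \<alpha> \<beta> (complex_of_real \<delta> - s) / Omega k \<alpha> \<beta> s"

definition zeta_trunc ::
    "(nat \<Rightarrow> complex) \<Rightarrow> (nat \<Rightarrow> real) \<Rightarrow> real \<Rightarrow> real \<Rightarrow> nat \<Rightarrow> (nat \<Rightarrow> real) \<Rightarrow> (nat \<Rightarrow> real) \<Rightarrow>
     nat \<Rightarrow> complex \<Rightarrow> complex" where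
  "zeta_trunc a l L \<delta> k \<alpha> \<beta> N s =
     F_trunc a l N s + G_factor L \<delta> k \<alpha> \<beta> s * F_trunc a l N (complex_of_real \<delta> - s)"

text \<open>
  \<open>F\<close> is the meromorphic function on the plane given by the Dirichlet series in a half-plane of
  absolute convergence.
\<close>

definition is_dirichlet_series_function ::
    "(nat \<Rightarrow> complex) \<Rightarrow> (nat \<Rightarrow> real) \<Rightarrow> (complex \<Rightarrow> complex) \<Rightarrow> bool" where
  "is_dirichlet_series_function a l F \<longleftrightarrow>
     F meromorphic_on UNIV \<and>
     (\<exists>\<sigma>\<^sub>0. \<forall>s. Re s > \<sigma>\<^sub>0 \<longrightarrow>
        summable (\<lambda>n. norm (dirichlet_term a l s (Suc n))) \<and>
        (\<lambda>n. dirichlet_term a l s (Suc n)) sums F s)"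

text \<open>
  An identity of meromorphic functions: it is only required off a sparse set, because at poles of
  \<open>F\<close> or \<open>Gamma\<close> the totalised values carry no information.
\<close>

definition functional_equation ::
    "(complex \<Rightarrow> complex) \<Rightarrow> real \<Rightarrow> real \<Rightarrow> nat \<Rightarrow> (nat \<Rightarrow> real) \<Rightarrow> (nat \<Rightarrow> real) \<Rightarrow> bool" where
  "functional_equation F L \<delta> k \<alpha> \<beta> \<longleftrightarrow>
     (\<forall>\<^sub>\<approx>s\<in>UNIV. Omega k \<alpha> \<beta> s * F s =
        complex_of_real L powr (2 * s - complex_of_real \<delta>) *
        Omega k \<alpha> \<beta> (complex_of_real \<delta> - s) * F (complex_of_real \<delta> - s))"

end

theory Submission
  imports Defs
begin

text \<open>
  Far to the right, \<open>F\<^sub>N(s) = a\<^sub>1 + a\<^sub>2 \<lambda>\<^sub>2\<^sup>-\<^sup>s + o(\<lambda>\<^sub>2\<^sup>-\<^sup>\<sigma>)\<close> uniformly in \<open>N\<close>, by absolute convergence. By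
  Euler's reflection formula, \<open>\<Gamma>(\<alpha>(\<delta> - s) + \<beta>) / \<Gamma>(\<alpha>s + \<beta>)\<close> is the reciprocal of a sine times two Gamma values
  with large real part and equal imaginary part. Since \<open>\<bar>\<Gamma>(x + iy)\<bar>\<^sup>2 \<ge> \<Gamma>(x)\<^sup>2 / cosh(\<pi>y)\<close> for \<open>x \<ge> 1/2\<close>, the
  exponential decay in \<open>y\<close> cancels against the sine, and \<open>G(s)\<close> decays like
  \<open>\<sigma>\<close> to the power \<open>-c\<sigma>\<close>, uniformly in \<open>\<bar>t\<bar> \<ge> 1\<close>. This
  beats \<open>F\<^sub>N(\<delta> - s)\<close>, which is at most \<open>(C N\<^sup>\<kappa>)\<^sup>\<sigma>\<close>, as soon as \<open>\<sigma>\<close> exceeds a suitable power of \<open>N\<close>. The left side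
  reduces to the right side by \<open>\<zeta>\<^sub>N(s) = G(s) \<zeta>\<^sub>N(\<delta> - s)\<close> and \<open>G(s) G(\<delta> - s) = 1\<close>: there \<open>\<bar>G(s)\<bar>\<close> is enormous, while
  \<open>\<zeta>\<^sub>N(\<delta> - s)\<close> is at least of order \<open>\<lambda>\<^sub>2\<^sup>-\<^sup>\<sigma>\<close> with \<open>\<sigma> = Re (\<delta> - s)\<close>.
\<close>

subsection \<open>Bounds for the Gamma function\<close>

text \<open>Factor by factor: \<open>\<bar>x + iy + n\<bar> / (x + n)\<close> is the square root of
  \<open>1 + (y / (x + n))\<^sup>2\<close>, which decreases in \<open>x\<close>. The
  cross-multiplied form avoids division.\<close>

lemma norm_pochhammer_ratio_mono:
  fixes h x y :: real
  assumes "0 < h" "h \<le> x"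
  shows "norm (pochhammer (Complex x y) n) * pochhammer h n \<le> norm (pochhammer (Complex h y) n) * pochhammer x n"
proof (induction n)
  case (Suc n)
  have step: "norm (Complex x y + of_nat n) * (h + of_nat n) \<le> norm (Complex h y + of_nat n) * (x + of_nat n)"
  proof (rule power2_le_imp_le)
    have "(h + real n)\<^sup>2 \<le> (x + real n)\<^sup>2" using assms by (intro power_mono) auto
    hence "y\<^sup>2 * (h + real n)\<^sup>2 \<le> y\<^sup>2 * (x + real n)\<^sup>2" by (intro mult_left_mono) auto
    thus "(norm (Complex x y + of_nat n) * (h + of_nat n))\<^sup>2 \<le> (norm (Complex h y + of_nat n) * (x + of_nat n))\<^sup>2"
      unfolding power_mult_distrib cmod_power2 distrib_right by simp
  qed (use assms in auto)
  have "(norm (pochhammer (Complex x y) n) * pochhammer h n) * (norm (Complex x y + of_nat n) * (h + of_nat n))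
     \<le> (norm (pochhammer (Complex h y) n) * pochhammer x n) * (norm (Complex h y + of_nat n) * (x + of_nat n))"
    by (rule mult_mono[OF Suc.IH step]) (use assms in \<open>auto intro!: mult_nonneg_nonneg pochhammer_nonneg\<close>)
  thus ?case by (simp add: pochhammer_Suc norm_mult mult_ac)
qed simp

text \<open>
  \<open>\<bar>\<Gamma>(x + iy)\<bar> / \<Gamma>(x)\<close> increases with \<open>x\<close>; at \<open>x = 1/2\<close> the reflection formula evaluates it.
\<close>

lemma norm_Gamma_ratio_mono:
  fixes h x y :: real
  assumes "0 < h" "h \<le> x"
  shows "norm (Gamma (Complex h y)) * Gamma x \<le> norm (Gamma (Complex x y)) * Gamma h"
proof (rule LIMSEQ_le)
  show "(\<lambda>n. norm (Gamma_series (Complex h y) n) * Gamma_series x n) \<longlonglongrightarrow> norm (Gamma (Complex h y)) * Gamma x"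
    by (intro tendsto_intros Gamma_series_LIMSEQ)
  show "(\<lambda>n. norm (Gamma_series (Complex x y) n) * Gamma_series h n) \<longlonglongrightarrow> norm (Gamma (Complex x y)) * Gamma h"
    by (intro tendsto_intros Gamma_series_LIMSEQ)
  \<comment> \<open>The factors \<open>n!\<close> and the norms of the powers of \<open>n\<close>,
    which depend only on real parts, agree on both sides. The Pochhammer symbols stand in the
    denominators, which reverses their inequality.\<close>
  have "norm (Gamma_series (Complex h y) n) * Gamma_series x n \<le> norm (Gamma_series (Complex x y) n) * Gamma_series h n" for n
  proof -
    have n: "norm (Gamma_series (Complex r y) n) = fact n * exp (r * ln (real n)) / norm (pochhammer (Complex r y) (n + 1))" for r
      by (simp add: Gamma_series_def norm_divide norm_mult flip: Ln_of_nat)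
    have nz: "pochhammer (Complex r y) (n + 1) \<noteq> 0" if "r > 0" for r
      using that by (auto simp: pochhammer_eq_0_iff dest: arg_cong[of _ _ Re])
    have pos: "pochhammer r (n + 1) > 0" if "r > 0" for r :: real
      using that by (rule pochhammer_pos)
    show ?thesis
      unfolding n unfolding Gamma_series_def
      using norm_pochhammer_ratio_mono[OF assms, of y "n + 1"] nz[of h] nz[of x] pos[of h] pos[of x] assms
      by (simp add: field_simps del: pochhammer_Suc)
  qed
  thus "\<exists>N. \<forall>n\<ge>N. norm (Gamma_series (Complex h y) n) * Gamma_series x n \<le> norm (Gamma_series (Complex x y) n) * Gamma_series h n"
    by blast
qed

text \<open>On the line of real part 1/2 one has \<open>1 - z = cnj z\<close>, so the reflection
  formula yields the squared norm, and the sine there has norm exactly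
  \<open>cosh (pi * y)\<close>.\<close>

lemma norm_Gamma_one_half:
  "(norm (Gamma (Complex (1/2) y)))\<^sup>2 = pi / cosh (pi * y)"
proof -
  define z where "z = Complex (1/2) y"
  have "(norm (sin (of_real pi * z)))\<^sup>2 = (cosh (pi * y))\<^sup>2"
    unfolding norm_sin_squared
    by (simp add: z_def cosh_field_def power2_eq_square algebra_simps mult_exp_exp
        flip: exp_minus exp_add)
  hence sin: "norm (sin (of_real pi * z)) = cosh (pi * y)"
    by (simp add: power2_eq_iff_nonneg cosh_real_nonneg)
  have "cnj z = 1 - z"
    by (simp add: z_def complex_eq_iff)
  hence "norm (Gamma (1 - z)) = norm (Gamma z)"
    by (metis complex_mod_cnj cnj_Gamma)
  hence "(norm (Gamma z))\<^sup>2 = norm (Gamma z * Gamma (1 - z))"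
    by (simp add: power2_eq_square norm_mult)
  also have "\<dots> = pi / cosh (pi * y)"
    by (simp add: Gamma_reflection_complex norm_divide sin)
  finally show ?thesis
    by (simp add: z_def)
qed

text \<open>Monotonicity of the ratio, started at 1/2; the factor \<open>pi\<close> cancels against
  \<open>(Gamma (1/2))\<^sup>2\<close>.\<close>

lemma norm_Gamma_ge:
  fixes x y :: real
  assumes "x \<ge> 1/2"
  shows "(Gamma x)\<^sup>2 \<le> (norm (Gamma (Complex x y)))\<^sup>2 * cosh (pi * y)"
proof -
  have "(norm (Gamma (Complex (1/2) y)) * Gamma x)\<^sup>2 \<le> (norm (Gamma (Complex x y)) * Gamma (1/2))\<^sup>2"
    using assms by (intro power_mono norm_Gamma_ratio_mono) (auto intro!: mult_nonneg_nonneg Gamma_real_nonneg)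
  thus ?thesis
    by (simp add: power_mult_distrib norm_Gamma_one_half Gamma_one_half_real field_simps cosh_real_pos)
qed

text \<open>Cut Euler's integral down to \<open>t \<ge> y\<close> and bound the power by its value
  at \<open>y\<close>. With \<open>y\<close> free to be chosen later, this replaces Stirling's
  formula.\<close>

lemma Gamma_real_ge_powr:
  fixes x y :: real
  assumes "x \<ge> 1" "y > 0"
  shows "y powr (x - 1) * exp (-y) \<le> Gamma x"
proof -
  have 1: "((\<lambda>t. if t \<in> {y..} then y powr (x - 1) * exp (- t) else 0) has_integral y powr (x - 1) * exp (-y)) {0..}"
    using has_integral_mult_right[OF has_integral_exp_minus_to_infinity[of 1 y], of "y powr (x - 1)"] assms
    by (subst has_integral_restrict) auto
  show ?thesis
    using assms by (intro has_integral_le[OF 1 Gamma_integral_real])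
       (auto simp: exp_minus field_simps intro!: mult_left_mono powr_mono2)
qed

lemma norm_sin_ge_sinh: "\<bar>sinh (Im z)\<bar> \<le> norm (sin z)"
proof (rule abs_le_square_iff[THEN iffD2, of _ "norm (sin z)", simplified])
  have "(sinh (Im z))\<^sup>2 = (exp (2 * Im z) + inverse (exp (2 * Im z)) - 2) / 4"
    by (simp add: sinh_field_def power2_eq_square algebra_simps mult_exp_exp flip: exp_minus)
  thus "(sinh (Im z))\<^sup>2 \<le> (norm (sin z))\<^sup>2"
    by (simp add: norm_sin_squared)
qed

text \<open>The difference of \<open>cosh\<close> and \<open>sinh\<close> at
  \<open>\<bar>y\<bar>\<close> is at most 1, hence at most
  \<open>sinh \<bar>y\<bar> / sinh d\<close>. Staying a distance \<open>d\<close> away from 0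
  corresponds to staying away from the real zeros of the sine.\<close>

lemma cosh_le_abs_sinh:
  fixes d y :: real
  assumes "d > 0" "d \<le> \<bar>y\<bar>"
  shows "cosh y \<le> (1 + 1 / sinh d) * \<bar>sinh y\<bar>"
proof -
  have d: "0 < sinh d" "sinh d \<le> sinh \<bar>y\<bar>"
    using assms by (auto simp del: sinh_real_abs)
  have "cosh \<bar>y\<bar> = sinh \<bar>y\<bar> + exp (-\<bar>y\<bar>)"
    by (simp add: cosh_field_def sinh_field_def field_simps)
  also have "exp (-\<bar>y\<bar>) \<le> 1"
    by simp
  also have "1 \<le> sinh \<bar>y\<bar> / sinh d"
    using d by (simp only: pos_le_divide_eq mult_1)
  finally show ?thesis
    by (simp add: algebra_simps)
qed

text \<open>Reflection replaces \<open>Gamma w\<close> by \<open>pi\<close> over a sine times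
  \<open>Gamma (1 - w)\<close>. Now \<open>z\<close> and \<open>1 - w\<close> have equal imaginary
  parts and real parts at least 1/2, so \<open>norm_Gamma_ge\<close> costs one factor
  \<open>cosh\<close> in total, which the sine pays for.\<close>

lemma norm_Gamma_quotient_le:
  fixes w z :: complex
  assumes "Re z \<ge> 1/2" "Re w \<le> 1/2" "Im w = - Im z" "0 < d" "d \<le> \<bar>Im z\<bar>"
  shows "norm (Gamma w / Gamma z) * (Gamma (Re z) * Gamma (1 - Re w)) \<le> pi * (1 + 1 / sinh (pi * d))"
proof -
  define K where "K = 1 + 1 / sinh (pi * d)"
  define C where "C = cosh (pi * Im z)"
  have G: "(Gamma (Re z))\<^sup>2 \<le> (norm (Gamma z))\<^sup>2 * C" "(Gamma (1 - Re w))\<^sup>2 \<le> (norm (Gamma (1 - w)))\<^sup>2 * C"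
    using norm_Gamma_ge[of "Re z" "Im z"] norm_Gamma_ge[of "Re (1 - w)" "Im (1 - w)"] assms(1-3)
    by (simp_all add: C_def complex_surj minus_complex.code one_complex.code)
  have C: "C > 0" by (simp add: C_def)
  have "(Gamma (Re z) * Gamma (1 - Re w))\<^sup>2 \<le> (norm (Gamma z) * norm (Gamma (1 - w)) * C)\<^sup>2"
    using mult_mono[OF G] C by (simp add: power_mult_distrib power2_eq_square mult_ac)
  hence "Gamma (Re z) * Gamma (1 - Re w) \<le> norm (Gamma z) * norm (Gamma (1 - w)) * C"
    by (rule power2_le_imp_le) (use C in auto)
  also have "C \<le> K * norm (sin (of_real pi * w))"
  proof -
    have "C \<le> K * \<bar>sinh (pi * Im z)\<bar>"
      unfolding C_def K_def using assms(4,5) by (intro cosh_le_abs_sinh) (auto simp: abs_mult)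
    also have "\<bar>sinh (pi * Im z)\<bar> \<le> norm (sin (of_real pi * w))"
      using norm_sin_ge_sinh[of "of_real pi * w"] assms(3) by simp
    finally show ?thesis
      using assms(4) by (auto simp: K_def mult_left_mono)
  qed
  finally have "norm (Gamma w / Gamma z) * (Gamma (Re z) * Gamma (1 - Re w))
      \<le> norm (Gamma w / Gamma z) * (norm (Gamma z) * norm (Gamma (1 - w)) * (K * norm (sin (of_real pi * w))))"
    by (intro mult_left_mono) (auto simp: mult_left_mono)
  \<comment> \<open>The inequality makes it unnecessary to show \<open>Gamma z \<noteq> 0\<close>:
    division by zero would make the left side 0.\<close>
  also have "\<dots> \<le> K * (norm (Gamma w * Gamma (1 - w)) * norm (sin (of_real pi * w)))"
    using assms(4) by (auto simp: norm_mult norm_divide K_def)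
  also have "\<dots> \<le> K * pi"
    using assms(4) by (intro mult_left_mono) (auto simp: Gamma_reflection_complex norm_divide K_def)
  finally show ?thesis
    by (simp add: K_def mult_ac)
qed

subsection \<open>Decay of the factor G\<close>

text \<open>
  The single parameter \<open>c\<close> plays the role of both \<open>\<sigma>\<^sub>b\<close> and \<open>\<gamma>\<close>: \<open>c N\<^sup>c\<close> is increasing in \<open>c\<close>, so
  these sets are directed. Both signs of \<open>Im s\<close> are included because \<open>s \<mapsto> \<delta> - s\<close> changes the sign.
\<close>

definition far_right :: "(nat \<times> complex) filter" where
  "far_right = (INF c\<in>{0<..}. principal {(N, s). 1 \<le> N \<and> 1 \<le> \<bar>Im s\<bar> \<and> c * real N powr c \<le> Re s})"

lemma eventually_far_right:
  "eventually P far_right \<longleftrightarrow>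
     (\<exists>c>0. \<forall>N s. 1 \<le> N \<longrightarrow> 1 \<le> \<bar>Im s\<bar> \<longrightarrow> c * real N powr c \<le> Re s \<longrightarrow> P (N, s))"
proof -
  have mono: "b * real N powr b \<le> c * real N powr c" if "0 < b" "b \<le> c" "1 \<le> N" for b c :: real and N :: nat
    using that by (intro mult_mono powr_mono) simp_all
  have "eventually P far_right \<longleftrightarrow>
      (\<exists>c\<in>{0<..}. eventually P (principal {(N, s). 1 \<le> N \<and> 1 \<le> \<bar>Im s\<bar> \<and> c * real N powr c \<le> Re s}))"
    unfolding far_right_def
  proof (rule eventually_INF_base)
    fix b c :: real assume bc: "b \<in> {0<..}" "c \<in> {0<..}"
    show "\<exists>d\<in>{0<..}. principal {(N, s). 1 \<le> N \<and> 1 \<le> \<bar>Im s\<bar> \<and> d * real N powr d \<le> Re s}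
        \<le> inf (principal {(N, s). 1 \<le> N \<and> 1 \<le> \<bar>Im s\<bar> \<and> b * real N powr b \<le> Re s})
            (principal {(N, s). 1 \<le> N \<and> 1 \<le> \<bar>Im s\<bar> \<and> c * real N powr c \<le> Re s})"
      using bc order_trans[OF mono[of b "max b c"]] order_trans[OF mono[of c "max b c"]]
      by (intro bexI[of _ "max b c"]) (auto simp: less_max_iff_disj)
  qed auto
  thus ?thesis
    unfolding eventually_principal by (simp add: Bex_def case_prod_beta imp_conjL)
qed

lemma eventually_far_rightI:
  assumes "\<And>N s. 1 \<le> N \<Longrightarrow> 1 \<le> \<bar>Im s\<bar> \<Longrightarrow> c * real N powr \<kappa> \<le> Re s \<Longrightarrow> P (N, s)"
  shows "eventually P far_right"
  unfolding eventually_far_right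
\<comment> \<open>The 1 keeps the witness positive even if \<open>c\<close> and
  \<open>\<kappa>\<close> are not.\<close>
proof (intro exI[of _ "max 1 (max c \<kappa>)"] conjI allI impI)
  fix N :: nat and s :: complex
  let ?m = "max 1 (max c \<kappa>)"
  assume N: "1 \<le> N" "1 \<le> \<bar>Im s\<bar>" "?m * real N powr ?m \<le> Re s"
  have "c * real N powr \<kappa> \<le> ?m * real N powr ?m"
    using N(1) by (intro mult_mono powr_mono) simp_all
  thus "P (N, s)"
    using N by (intro assms) simp_all
qed simp

lemma filterlim_Re_far_right: "filterlim (\<lambda>x. Re (snd x)) at_top far_right"
  unfolding filterlim_at_top
proof
  fix Z
  show "eventually (\<lambda>x. Z \<le> Re (snd x)) far_right"
    by (rule eventually_far_rightI[of Z 0]) simp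
qed

lemma eventually_far_right_Re:
  assumes "eventually P at_top"
  shows "eventually (\<lambda>(N, s). P (Re s)) far_right"
  using eventually_compose_filterlim[OF assms filterlim_Re_far_right] by (simp add: case_prod_unfold)

text \<open>The quotient decays faster than every exponential in \<open>Re s\<close>. It therefore
  absorbs even a base that grows like a power of \<open>N\<close>, once \<open>Re s\<close> exceeds
  another power of \<open>N\<close>.\<close>

lemma Gamma_quotient_far_right:
  fixes \<alpha> \<beta> \<delta> B \<kappa> :: real
  assumes "\<alpha> > 0" "B \<ge> 1" "\<kappa> \<ge> 0"
  shows "eventually (\<lambda>(N, s). norm (Gamma (of_real \<alpha> * (of_real \<delta> - s) + of_real \<beta>) /
             Gamma (of_real \<alpha> * s + of_real \<beta>)) * (B * real N powr \<kappa>) powr Re s \<le> 1) far_right"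
proof -
  \<comment> \<open>The bound of \<open>norm_Gamma_quotient_le\<close> for
    \<open>d = \<alpha>\<close>, since \<open>\<bar>Im s\<bar> \<ge> 1\<close> makes the imaginary
    parts at least \<open>\<alpha>\<close> in size.\<close>
  define K where "K = pi * (1 + 1 / sinh (pi * \<alpha>))"
  define D where "D = exp 2 * B"
  \<comment> \<open>\<open>y\<close> is the free parameter of \<open>Gamma_real_ge_powr\<close>. One factor \<open>exp (Re s)\<close> of \<open>exp 2 powr Re s\<close> pays for
     \<open>exp (-2 y)\<close>, the other for \<open>K\<close>.\<close>
  define y where "y N = (D * real N powr \<kappa>) powr (1 / \<alpha>)" for N :: nat
  have K: "K > 0" using assms by (auto simp: K_def intro!: add_pos_nonneg mult_pos_pos)
  have D: "D \<ge> 1" using mult_mono[of 1 "exp 2" 1 B] assms by (simp add: D_def)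
  have "eventually (\<lambda>(N, s). 1 \<le> N \<and> 1 \<le> \<bar>Im s\<bar> \<and> 2 * y N \<le> Re s) far_right"
    using D by (intro eventually_far_rightI[of "2 * D powr (1 / \<alpha>)" "\<kappa> / \<alpha>"])
      (auto simp: y_def powr_mult powr_powr)
  \<comment> \<open>In order, these give real part at least 1 for the denominator's argument, at
    most 0 for the numerator's, a total exponent of \<open>y\<close> of at least
    \<open>\<alpha> * Re s\<close>, and \<open>K \<le> exp (Re s)\<close>.\<close>
  moreover have "eventually (\<lambda>(N, s). (1 - \<beta>) / \<alpha> \<le> Re s \<and> \<delta> + \<beta> / \<alpha> \<le> Re s \<and> \<delta> + 1 / \<alpha> \<le> Re s \<and> ln K \<le> Re s) far_right"
    by (intro eventually_far_right_Re eventually_conj eventually_ge_at_top)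
  ultimately show ?thesis
  proof (eventually_elim, clarify)
    fix N :: nat and s :: complex
    define z where "z = of_real \<alpha> * s + of_real \<beta>"
    define w where "w = of_real \<alpha> * (of_real \<delta> - s) + of_real \<beta>"
    assume N: "1 \<le> N" "1 \<le> \<bar>Im s\<bar>" "2 * y N \<le> Re s"
      and s: "(1 - \<beta>) / \<alpha> \<le> Re s" "\<delta> + \<beta> / \<alpha> \<le> Re s" "\<delta> + 1 / \<alpha> \<le> Re s" "ln K \<le> Re s"
    have DN: "1 \<le> D * real N powr \<kappa>"
      using mult_mono[OF D ge_one_powr_ge_zero[of "real N" \<kappa>]] D N assms by auto
    hence y: "1 \<le> y N"
      using assms by (auto simp: y_def intro!: ge_one_powr_ge_zero)
    have re: "1 \<le> Re z" "1 \<le> 1 - Re w" "\<alpha> * Re s \<le> (Re z - 1) + (1 - Re w - 1)"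
      using s assms by (auto simp: z_def w_def field_simps)
    have "(B * real N powr \<kappa>) powr Re s * exp (Re s) = (D * real N powr \<kappa>) powr Re s * exp (- Re s)"
      using assms by (simp add: D_def powr_mult powr_def[of "exp 2"] mult_exp_exp mult_ac)
    also have "(D * real N powr \<kappa>) powr Re s = y N powr (\<alpha> * Re s)"
      using assms by (simp add: y_def powr_powr)
    also have "\<dots> * exp (- Re s) \<le> y N powr ((Re z - 1) + (1 - Re w - 1)) * exp (- y N + - y N)"
      using y re N by (intro mult_mono powr_mono) auto
    also have "\<dots> = (y N powr (Re z - 1) * exp (- y N)) * (y N powr (1 - Re w - 1) * exp (- y N))"
      unfolding powr_add exp_add by (simp only: mult_ac)
    also have "\<dots> \<le> Gamma (Re z) * Gamma (1 - Re w)"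
      using y re by (intro mult_mono Gamma_real_ge_powr) (auto intro!: mult_nonneg_nonneg Gamma_real_nonneg)
    finally have "norm (Gamma w / Gamma z) * ((B * real N powr \<kappa>) powr Re s * exp (Re s))
        \<le> norm (Gamma w / Gamma z) * (Gamma (Re z) * Gamma (1 - Re w))"
      by (intro mult_left_mono) auto
    also have "\<dots> \<le> K"
      unfolding K_def
      by (rule norm_Gamma_quotient_le) (use re N assms in \<open>auto simp: z_def w_def abs_mult\<close>)
    also have "\<dots> \<le> exp (Re s)"
      using s(4) K by (metis exp_le_cancel_iff exp_ln)
    finally show "norm (Gamma w / Gamma z) * (B * real N powr \<kappa>) powr Re s \<le> 1"
      by (simp add: mult_ac)
  qed
qed

lemma G_factor_far_right:
  fixes L \<delta> B \<kappa> :: real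
  assumes "L > 0" "k \<ge> 1" "\<forall>i\<in>{1..k}. \<alpha> i > 0" "B \<ge> 1" "\<kappa> \<ge> 0"
  shows "eventually (\<lambda>(N, s). norm (G_factor L \<delta> k \<alpha> \<beta> s) * (B * real N powr \<kappa>) powr Re s \<le> 1) far_right"
proof -
  \<comment> \<open>As \<open>\<bar>2 * Re s - \<delta>\<bar> \<le> 3 * Re s\<close> far to the
    right, the power of \<open>L\<close> is at most \<open>M powr Re s\<close>, and \<open>M\<close>
    can be merged into the base \<open>B\<close>.\<close>
  define M where "M = exp (3 * \<bar>ln L\<bar>)"
  define q where "q i s = Gamma (of_real (\<alpha> i) * (of_real \<delta> - s) + of_real (\<beta> i)) /
      Gamma (of_real (\<alpha> i) * s + of_real (\<beta> i))" for i and s :: complex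
  have M: "M \<ge> 1" by (simp add: M_def)
  have MB: "M * B \<ge> 1" using mult_mono[OF M assms(4)] M by auto
  have "eventually (\<lambda>x. \<forall>i\<in>{1..k}. norm (q i (snd x)) * (M * B * real (fst x) powr \<kappa>) powr Re (snd x) \<le> 1) far_right"
    using Gamma_quotient_far_right[OF bspec[OF assms(3)] MB assms(5)]
    by (intro eventually_ball_finite ballI finite_atLeastAtMost) (simp only: case_prod_unfold q_def)
  moreover have "eventually (\<lambda>(N, s). 1 \<le> N \<and> 0 \<le> Re s \<and> \<bar>\<delta>\<bar> \<le> Re s) far_right"
    by (rule eventually_far_rightI[of "\<bar>\<delta>\<bar>" 0]) auto
  ultimately show ?thesis
  proof (eventually_elim, clarify)
    fix N :: nat and s :: complex
    define X where "X = (M * B * real N powr \<kappa>) powr Re s"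
    assume q: "\<forall>i\<in>{1..k}. norm (q i (snd (N, s))) * (M * B * real (fst (N, s)) powr \<kappa>) powr Re (snd (N, s)) \<le> 1"
      and N: "1 \<le> N" "0 \<le> Re s" "\<bar>\<delta>\<bar> \<le> Re s"
    have "1 \<le> M * B * real N powr \<kappa>"
      using mult_mono[OF MB ge_one_powr_ge_zero[of "real N" \<kappa>]] MB N assms by auto
    hence X: "1 \<le> X"
      using N by (auto simp: X_def intro!: ge_one_powr_ge_zero)
    have "norm (q i s) \<le> 1 / X" if "i \<in> {1..k}" for i
      using bspec[OF q that] X by (simp add: X_def[symmetric] pos_le_divide_eq)
    hence "(\<Prod>i=1..k. norm (q i s)) \<le> (1 / X) ^ k"
      using prod_mono[of "{1..k}" "\<lambda>i. norm (q i s)" "\<lambda>_. 1 / X"] by simp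
    \<comment> \<open>All quotients are at most 1, so the decay of a single one suffices. An empty
      product would give none; \<open>k \<ge> 1\<close> enters here.\<close>
    also have "\<dots> \<le> (1 / X) ^ 1"
      using X assms(2) by (intro power_decreasing) auto
    finally have prod: "(\<Prod>i=1..k. norm (q i s)) * X \<le> 1"
      using X by (simp add: pos_le_divide_eq)
    have "norm (of_real L powr (2 * s - of_real \<delta>)) = exp ((2 * Re s - \<delta>) * ln L)"
      using assms(1) by (simp add: norm_powr_real_powr powr_def)
    also have "\<dots> \<le> M powr Re s"
    proof -
      have "(2 * Re s - \<delta>) * ln L \<le> \<bar>2 * Re s - \<delta>\<bar> * \<bar>ln L\<bar>"
        by (metis abs_ge_self abs_mult)
      also have "\<dots> \<le> (3 * Re s) * \<bar>ln L\<bar>"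
        using N by (intro mult_right_mono) auto
      finally have "(2 * Re s - \<delta>) * ln L \<le> (3 * Re s) * \<bar>ln L\<bar>" .
      thus ?thesis by (simp add: M_def powr_def mult_ac)
    qed
    finally have Lp: "norm (of_real L powr (2 * s - of_real \<delta>)) \<le> M powr Re s" .
    have "norm (G_factor L \<delta> k \<alpha> \<beta> s) = norm (of_real L powr (2 * s - of_real \<delta>)) * (\<Prod>i=1..k. norm (q i s))"
      by (simp add: G_factor_def Omega_def q_def norm_mult norm_divide prod_norm prod_dividef)
    also have "\<dots> * (B * real N powr \<kappa>) powr Re s
        \<le> (M powr Re s * (\<Prod>i=1..k. norm (q i s))) * (B * real N powr \<kappa>) powr Re s"
      using Lp by (intro mult_right_mono) (auto intro!: prod_nonneg)
    also have "\<dots> = (\<Prod>i=1..k. norm (q i s)) * X"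
      using M assms by (simp add: X_def powr_mult mult_ac)
    also note prod
    finally show "norm (G_factor L \<delta> k \<alpha> \<beta> s) * (B * real N powr \<kappa>) powr Re s \<le> 1" .
  qed
qed

lemma bigo_powr_imp_bound:
  fixes f :: "nat \<Rightarrow> real"
  assumes "f \<in> O(\<lambda>n. real n powr K)"
  obtains C \<kappa> where "C \<ge> 1" "\<kappa> \<ge> 0" "\<And>n. n \<ge> 1 \<Longrightarrow> \<bar>f n\<bar> \<le> C * real n powr \<kappa>"
proof -
  from assms obtain c where "eventually (\<lambda>n. norm (f n) \<le> c * norm (real n powr K)) at_top"
    by (auto elim!: landau_o.bigE)
  then obtain m where m: "\<And>n. n \<ge> m \<Longrightarrow> \<bar>f n\<bar> \<le> c * real n powr K"
    by (auto simp: eventually_at_top_linorder)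
  \<comment> \<open>The sum takes care of the finitely many indices below \<open>m\<close>.\<close>
  define C where "C = max 1 c + (\<Sum>i<m. \<bar>f i\<bar>)"
  have S: "0 \<le> (\<Sum>i<m. \<bar>f i\<bar>)" by (intro sum_nonneg) auto
  show ?thesis
  proof (rule that)
    show "C \<ge> 1" "max K 0 \<ge> 0" using S by (auto simp: C_def intro!: add_increasing2)
    fix n :: nat assume n: "n \<ge> 1"
    have p: "1 \<le> real n powr max K 0" using n by (intro ge_one_powr_ge_zero) auto
    show "\<bar>f n\<bar> \<le> C * real n powr max K 0"
    proof (cases "n < m")
      case True
      hence "\<bar>f n\<bar> \<le> (\<Sum>i<m. \<bar>f i\<bar>)" by (intro member_le_sum) auto
      hence "\<bar>f n\<bar> * 1 \<le> C * real n powr max K 0"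
        using p S by (intro mult_mono) (auto simp: C_def)
      thus ?thesis by simp
    next
      case False
      hence "\<bar>f n\<bar> \<le> c * real n powr K" using m by auto
      also have "\<dots> \<le> C * real n powr max K 0"
        using S n by (intro mult_mono powr_mono) (auto simp: C_def intro!: add_increasing2)
      finally show ?thesis .
    qed
  qed
qed

subsection \<open>The truncated series and its reflection\<close>

lemma eventually_powr_less:
  fixes q \<epsilon> :: real
  assumes "0 < q" "q < 1" "0 < \<epsilon>"
  shows "eventually (\<lambda>x. q powr x < \<epsilon>) at_top"
  using eventually_gt_at_top[of "ln \<epsilon> / ln q"]
proof eventually_elim
  case (elim x)
  hence "x * ln q < ln \<epsilon>"
    using assms by (simp add: neg_divide_less_eq)
  hence "exp (x * ln q) < exp (ln \<epsilon>)" by simp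
  thus ?case
    using assms by (simp add: powr_def)
qed

lemma norm_dirichlet_term: "l n > 0 \<Longrightarrow> norm (dirichlet_term a l s n) = norm (a n) / l n powr Re s"
  by (simp add: dirichlet_term_def norm_divide norm_powr_real_powr)

text \<open>Off the real axis no Gamma argument is a pole, so no value is the default 0, and both
  \<open>Omega\<close> values are nonzero and cancel.\<close>

lemma G_factor_reflect:
  assumes "L > 0" "\<forall>i\<in>{1..k}. \<alpha> i > 0" "Im s \<noteq> 0"
  shows "G_factor L \<delta> k \<alpha> \<beta> s * G_factor L \<delta> k \<alpha> \<beta> (of_real \<delta> - s) = 1"
proof -
  have nz: "Omega k \<alpha> \<beta> z \<noteq> 0" if "Im z \<noteq> 0" for z
  proof -
    have "Gamma (of_real (\<alpha> i) * z + of_real (\<beta> i)) \<noteq> 0" if "i \<in> {1..k}" for i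
      using bspec[OF assms(2) that] \<open>Im z \<noteq> 0\<close>
      by (auto simp: Gamma_eq_zero_iff elim!: nonpos_Ints_cases dest: arg_cong[of _ _ Im])
    thus ?thesis by (simp add: Omega_def)
  qed
  have "of_real L powr (2 * s - of_real \<delta>) * of_real L powr (2 * (of_real \<delta> - s) - of_real \<delta>) = (1 :: complex)"
    using assms(1) by (simp add: algebra_simps flip: powr_add)
  thus ?thesis
    using nz[of s] nz[of "of_real \<delta> - s"] assms(3) by (simp add: G_factor_def)
qed

text \<open>Multiplication by \<open>G\<close> interchanges the two summands of the reflected
  function.\<close>

lemma zeta_trunc_reflect:
  assumes "L > 0" "\<forall>i\<in>{1..k}. \<alpha> i > 0" "Im s \<noteq> 0"
  shows "zeta_trunc a l L \<delta> k \<alpha> \<beta> N s = G_factor L \<delta> k \<alpha> \<beta> s * zeta_trunc a l L \<delta> k \<alpha> \<beta> N (of_real \<delta> - s)"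
proof -
  have "G_factor L \<delta> k \<alpha> \<beta> s * zeta_trunc a l L \<delta> k \<alpha> \<beta> N (of_real \<delta> - s) =
      G_factor L \<delta> k \<alpha> \<beta> s * F_trunc a l N (of_real \<delta> - s) +
      (G_factor L \<delta> k \<alpha> \<beta> s * G_factor L \<delta> k \<alpha> \<beta> (of_real \<delta> - s)) * F_trunc a l N s"
    by (simp add: zeta_trunc_def algebra_simps)
  also have "G_factor L \<delta> k \<alpha> \<beta> s * G_factor L \<delta> k \<alpha> \<beta> (of_real \<delta> - s) = 1"
    by (rule G_factor_reflect[OF assms])
  finally show ?thesis
    by (simp add: zeta_trunc_def)
qed

text \<open>A termwise bound with \<open>N\<close> terms suffices. Its shape, a power of
  \<open>N\<close> raised to \<open>Re s\<close>, is the one that \<open>G_factor_far_right\<close>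
  absorbs.\<close>

lemma F_trunc_dual_far_right:
  fixes a :: "nat \<Rightarrow> complex" and l :: "nat \<Rightarrow> real"
  assumes "\<And>n. 1 \<le> n \<Longrightarrow> 1 \<le> l n"
    and "\<exists>K::real. (\<lambda>n. norm (a n)) \<in> O(\<lambda>n. real n powr K)"
    and "\<exists>K::real. l \<in> O(\<lambda>n. real n powr K)"
  obtains C \<kappa> where "C \<ge> 1" "\<kappa> \<ge> 0"
    "eventually (\<lambda>(N, s). norm (F_trunc a l N (of_real \<delta> - s)) \<le> (C * real N powr \<kappa>) powr Re s) far_right"
proof -
  obtain A p where A: "A \<ge> 1" "p \<ge> 0" "\<And>n. n \<ge> 1 \<Longrightarrow> norm (a n) \<le> A * real n powr p"
    using assms(2) by (elim exE bigo_powr_imp_bound) auto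
  obtain B q where B: "B \<ge> 1" "q \<ge> 0" "\<And>n. n \<ge> 1 \<Longrightarrow> \<bar>l n\<bar> \<le> B * real n powr q"
    using assms(3) by (elim exE bigo_powr_imp_bound) auto
  have "eventually (\<lambda>(N, s). 1 \<le> N \<and> 1 \<le> Re s \<and> \<bar>\<delta>\<bar> \<le> Re s) far_right"
    by (rule eventually_far_rightI[of "max 1 \<bar>\<delta>\<bar>" 0]) simp
  hence ev: "eventually (\<lambda>(N, s). norm (F_trunc a l N (of_real \<delta> - s)) \<le>
      (A * B\<^sup>2 * real N powr (1 + p + 2 * q)) powr Re s) far_right"
  proof (eventually_elim, clarify)
    fix N :: nat and s :: complex
    assume N: "1 \<le> N" "1 \<le> Re s" "\<bar>\<delta>\<bar> \<le> Re s"
    define X where "X = B * real N powr q"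
    have X: "1 \<le> X"
      using mult_mono[OF B(1) ge_one_powr_ge_zero[of "real N" q]] B N by (simp add: X_def)
    have "norm (dirichlet_term a l (of_real \<delta> - s) n) \<le> A * real N powr p * X powr (2 * Re s)" if n: "n \<in> {1..N}" for n
    proof -
      have l: "1 \<le> l n" using assms(1) n by auto
      have an: "norm (a n) \<le> A * real N powr p"
        using A(1,2) n by (intro order_trans[OF A(3)] mult_left_mono powr_mono2) auto
      have "l n \<le> X"
      proof -
        have "l n \<le> B * real n powr q" using B(3)[of n] n l by auto
        also have "\<dots> \<le> X"
          unfolding X_def using B n by (intro mult_left_mono powr_mono2) auto
        finally show ?thesis .
      qed
      hence "l n powr (Re s - \<delta>) \<le> X powr (Re s - \<delta>)"
        using l N by (intro powr_mono2) auto
      also have "\<dots> \<le> X powr (2 * Re s)"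
        using X N by (intro powr_mono) auto
      finally have "norm (a n) * l n powr (Re s - \<delta>) \<le> A * real N powr p * X powr (2 * Re s)"
        using an A(1) by (intro mult_mono) auto
      moreover have "norm (dirichlet_term a l (of_real \<delta> - s) n) = norm (a n) * l n powr (Re s - \<delta>)"
        using l by (simp add: norm_dirichlet_term powr_diff)
      ultimately show ?thesis by simp
    qed
    hence "norm (F_trunc a l N (of_real \<delta> - s)) \<le> (\<Sum>n=1..N. A * real N powr p * X powr (2 * Re s))"
      unfolding F_trunc_def by (rule sum_norm_le)
    also have "\<dots> = (A * (real N powr 1 * real N powr p)) * X powr (2 * Re s)"
      using N by simp
    also have "\<dots> = (A * real N powr (1 + p)) powr 1 * X powr (2 * Re s)"
      using A(1) by (simp add: powr_add)
    \<comment> \<open>The polynomial prefactor is at least 1 and \<open>Re s \<ge> 1\<close>, so it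
      too may be raised to the power \<open>Re s\<close>.\<close>
    also have "\<dots> \<le> (A * real N powr (1 + p)) powr Re s * X powr (2 * Re s)"
      using A N mult_mono[OF A(1) ge_one_powr_ge_zero[of "real N" "1 + p"]]
      by (intro mult_right_mono powr_mono) simp_all
    also have "\<dots> = (A * real N powr (1 + p) * (X powr 2)) powr Re s"
      unfolding powr_mult powr_powr by (simp only: mult_ac)
    also have "X powr 2 = B\<^sup>2 * real N powr (2 * q)"
      using B(1) by (simp add: X_def powr_mult powr_powr mult.commute)
    also have "A * real N powr (1 + p) * (B\<^sup>2 * real N powr (2 * q)) = A * B\<^sup>2 * real N powr (1 + p + 2 * q)"
      by (simp add: powr_add)
    finally show "norm (F_trunc a l N (of_real \<delta> - s)) \<le>
      (A * B\<^sup>2 * real N powr (1 + p + 2 * q)) powr Re s" .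
  qed
  show ?thesis
  proof (rule that[OF _ _ ev])
    show "1 \<le> A * B\<^sup>2"
      using mult_mono[OF A(1) one_le_power[OF B(1), of 2]] A(1) by simp
  qed (use A B in auto)
qed

text \<open>For \<open>n \<ge> 3\<close>, moving from abscissa \<open>\<sigma>\<close> to
  \<open>Re s\<close> gains at least the factor \<open>l 3 powr (\<sigma> - Re s)\<close>. The rest
  is bounded by the full absolute sum at \<open>\<sigma>\<close>, uniformly in \<open>N\<close>, and
  \<open>l 2 / l 3 < 1\<close> makes the product small.\<close>

lemma F_trunc_far_right:
  fixes a :: "nat \<Rightarrow> complex" and l :: "nat \<Rightarrow> real"
  assumes mono: "strict_mono_on {1..} l" and l1: "l 1 = 1"
    and sm: "summable (\<lambda>n. norm (dirichlet_term a l (of_real \<sigma>) (Suc n)))" and \<epsilon>: "\<epsilon> > 0"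
  shows "eventually (\<lambda>(N, s). 2 \<le> N \<longrightarrow>
     norm (F_trunc a l N s - a 1 - dirichlet_term a l s 2) * l 2 powr Re s \<le> \<epsilon>) far_right"
proof -
  have lt: "l m < l n" if "1 \<le> m" "m < n" for m n
    using strict_mono_onD[OF mono, of m n] that by auto
  have le: "l m \<le> l n" if "1 \<le> m" "m \<le> n" for m n
    using lt[of m n] that by (cases "m = n") auto
  have l23: "1 < l 2" "l 2 < l 3" using lt[of 1 2] lt[of 2 3] l1 by auto
  define S where "S = (\<Sum>n. norm (dirichlet_term a l (of_real \<sigma>) (Suc n)))"
  have S: "S \<ge> 0" unfolding S_def using sm by (intro suminf_nonneg) auto
  \<comment> \<open>\<open>S + 1\<close> rather than \<open>S\<close>, so that \<open>T\<close> is
    positive and can be divided by.\<close>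
  define T where "T = (S + 1) * l 3 powr \<sigma>"
  have T: "T > 0" using S l23 by (simp add: T_def)
  have "eventually (\<lambda>x. (l 2 / l 3) powr x < \<epsilon> / T) at_top"
    using l23 \<epsilon> T by (intro eventually_powr_less) auto
  hence "eventually (\<lambda>x. (l 2 / l 3) powr x < \<epsilon> / T \<and> \<sigma> \<le> x) at_top"
    using eventually_ge_at_top by (rule eventually_conj)
  from eventually_far_right_Re[OF this] show ?thesis
  proof (eventually_elim, clarify)
    fix N :: nat and s :: complex
    assume s: "(l 2 / l 3) powr Re s < \<epsilon> / T" "\<sigma> \<le> Re s" and N: "2 \<le> N"
    have bound: "norm (dirichlet_term a l s n) \<le> norm (dirichlet_term a l (of_real \<sigma>) n) * l 3 powr (\<sigma> - Re s)"
      if n: "n \<in> {3..N}" for n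
    proof -
      have ln: "l 3 \<le> l n" using le[of 3 n] n by auto
      have "norm (dirichlet_term a l s n) = norm (dirichlet_term a l (of_real \<sigma>) n) * l n powr (\<sigma> - Re s)"
        using ln l23 by (simp add: norm_dirichlet_term powr_diff)
      also have "\<dots> \<le> norm (dirichlet_term a l (of_real \<sigma>) n) * l 3 powr (\<sigma> - Re s)"
        using ln l23 s(2) by (intro mult_left_mono powr_mono2') auto
      finally show ?thesis .
    qed
    have "{1..N} = insert 1 (insert 2 {3..N})" using N by auto
    hence "F_trunc a l N s - a 1 - dirichlet_term a l s 2 = (\<Sum>n=3..N. dirichlet_term a l s n)"
      by (simp add: F_trunc_def dirichlet_term_def[of _ _ _ "Suc 0"] l1[simplified])
    hence "norm (F_trunc a l N s - a 1 - dirichlet_term a l s 2)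
        \<le> (\<Sum>n=3..N. norm (dirichlet_term a l (of_real \<sigma>) n) * l 3 powr (\<sigma> - Re s))"
      using bound by (metis sum_norm_le)
    also have "\<dots> = (\<Sum>n=3..N. norm (dirichlet_term a l (of_real \<sigma>) n)) * l 3 powr (\<sigma> - Re s)"
      by (simp add: sum_distrib_right)
    also have "(\<Sum>n=3..N. norm (dirichlet_term a l (of_real \<sigma>) n))
        \<le> (\<Sum>n=1..N. norm (dirichlet_term a l (of_real \<sigma>) n))"
      by (intro sum_mono2) auto
    also have "\<dots> = (\<Sum>n<N. norm (dirichlet_term a l (of_real \<sigma>) (Suc n)))"
      by (rule sum.reindex_bij_witness[of _ Suc "\<lambda>n. n - 1"]) auto
    also have "\<dots> \<le> S"
      unfolding S_def using sm by (intro sum_le_suminf) auto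
    also have "S \<le> S + 1" by simp
    finally have "norm (F_trunc a l N s - a 1 - dirichlet_term a l s 2) \<le> (S + 1) * l 3 powr (\<sigma> - Re s)"
      by (simp add: mult_right_mono)
    hence "norm (F_trunc a l N s - a 1 - dirichlet_term a l s 2) * l 2 powr Re s
        \<le> (S + 1) * l 3 powr (\<sigma> - Re s) * l 2 powr Re s"
      by (rule mult_right_mono) simp
    also have "\<dots> = T * (l 2 / l 3) powr Re s"
      using l23 by (simp add: T_def powr_diff powr_divide)
    also have "\<dots> \<le> T * (\<epsilon> / T)"
      using s(1) T by (intro mult_left_mono) auto
    also have "\<dots> = \<epsilon>" using T by simp
    finally show "norm (F_trunc a l N s - a 1 - dirichlet_term a l s 2) * l 2 powr Re s \<le> \<epsilon>" .
  qed
qed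

section \<open>Asymptotics of \<open>\<zeta>\<^sub>N\<close> far to the right\<close>

text \<open>Scaling by \<open>l 2 powr s\<close> gives the precision required when the value is
  \<open>a 1\<close>; dividing it out again handles all other values. The conditional reflects that
  for \<open>N = 1\<close> the second term is missing.\<close>

lemma zeta_trunc_far_right:
  fixes a :: "nat \<Rightarrow> complex" and l :: "nat \<Rightarrow> real"
  assumes mono: "strict_mono_on {1..} l" and l1: "l 1 = 1"
    and growth: "\<exists>K::real. (\<lambda>n. norm (a n)) \<in> O(\<lambda>n. real n powr K)" "\<exists>K::real. l \<in> O(\<lambda>n. real n powr K)"
    and sm: "summable (\<lambda>n. norm (dirichlet_term a l (of_real \<sigma>) (Suc n)))"
    and G: "L > 0" "k \<ge> 1" "\<forall>i\<in>{1..k}. \<alpha> i > 0"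
    and \<epsilon>: "\<epsilon> > 0"
  shows "eventually (\<lambda>(N, s). norm ((zeta_trunc a l L \<delta> k \<alpha> \<beta> N s - a 1) * of_real (l 2) powr s -
     (if 2 \<le> N then a 2 else 0)) < \<epsilon>) far_right"
proof -
  have l: "1 \<le> l n" if "1 \<le> n" for n
    using strict_mono_onD[OF mono, of 1 n] that l1 by (cases "n = 1") auto
  have l2: "1 < l 2"
    using strict_mono_onD[OF mono, of 1 2] l1 by auto
  obtain C \<kappa> where C: "C \<ge> 1" "\<kappa> \<ge> 0"
    and F: "eventually (\<lambda>(N, s). norm (F_trunc a l N (of_real \<delta> - s)) \<le> (C * real N powr \<kappa>) powr Re s) far_right"
    using F_trunc_dual_far_right[OF l growth] by blast
  \<comment> \<open>In the base given to \<open>G_factor_far_right\<close>, \<open>C\<close> absorbs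
    the dual sum, \<open>l 2\<close> the scaling, and 2 leaves a spare factor
    \<open>(1/2) powr Re s\<close>.\<close>
  have CB: "1 \<le> 2 * l 2 * C"
    using mult_mono[of 1 "2 * l 2" 1 C] C l2 by simp
  have pow: "eventually (\<lambda>(N, s). (1/2) powr Re s < \<epsilon> / 2) far_right"
    using \<epsilon> by (intro eventually_far_right_Re eventually_powr_less) auto
  have N: "eventually (\<lambda>(N, s). 1 \<le> N) far_right"
    by (rule eventually_far_rightI) simp
  have "\<epsilon> / 2 > 0" using \<epsilon> by simp
  from F_trunc_far_right[OF mono l1 sm this] F G_factor_far_right[where \<delta>=\<delta> and \<beta>=\<beta>, OF G CB C(2)] pow N
  show ?thesis
  proof (eventually_elim, clarify)
    fix N :: nat and s :: complex
    define g where "g = G_factor L \<delta> k \<alpha> \<beta> s"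
    define f where "f = F_trunc a l N (of_real \<delta> - s)"
    assume tail: "2 \<le> N \<longrightarrow> norm (F_trunc a l N s - a 1 - dirichlet_term a l s 2) * l 2 powr Re s \<le> \<epsilon> / 2"
      and f: "norm (F_trunc a l N (of_real \<delta> - s)) \<le> (C * real N powr \<kappa>) powr Re s"
      and g: "norm (G_factor L \<delta> k \<alpha> \<beta> s) * (2 * l 2 * C * real N powr \<kappa>) powr Re s \<le> 1"
      and s: "(1/2) powr Re s < \<epsilon> / 2" and N: "1 \<le> N"
    have nl2: "norm (of_real (l 2) powr s :: complex) = l 2 powr Re s"
      using l2 by (simp add: norm_powr_real_powr)
    have "norm (g * f) * l 2 powr Re s * 2 powr Re s \<le> norm g * (C * real N powr \<kappa>) powr Re s * l 2 powr Re s * 2 powr Re s"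
      using f unfolding norm_mult f_def by (intro mult_right_mono mult_left_mono) auto
    also have "\<dots> = norm g * (2 * l 2 * C * real N powr \<kappa>) powr Re s"
      using l2 C by (simp add: powr_mult mult_ac)
    also note g[folded g_def]
    finally have "norm (g * f) * l 2 powr Re s \<le> (1/2) powr Re s"
      by (simp add: powr_divide field_simps)
    hence gf: "norm (g * f * of_real (l 2) powr s) < \<epsilon> / 2"
      using s by (simp add: norm_mult nl2)
    show "norm ((zeta_trunc a l L \<delta> k \<alpha> \<beta> N s - a 1) * of_real (l 2) powr s - (if 2 \<le> N then a 2 else 0)) < \<epsilon>"
    proof (cases "2 \<le> N")
      case True
      have "(zeta_trunc a l L \<delta> k \<alpha> \<beta> N s - a 1) * of_real (l 2) powr s - a 2 =
          (F_trunc a l N s - a 1 - dirichlet_term a l s 2) * of_real (l 2) powr s + g * f * of_real (l 2) powr s"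
        using l2 by (simp add: zeta_trunc_def dirichlet_term_def g_def f_def field_simps)
      also have "norm \<dots> < \<epsilon> / 2 + \<epsilon> / 2"
        using tail True gf by (intro norm_triangle_lt add_le_less_mono) (auto simp: norm_mult nl2)
      finally show ?thesis using True by simp
    next
      case False
      hence "N = 1" using N by simp
      hence "zeta_trunc a l L \<delta> k \<alpha> \<beta> N s - a 1 = g * f"
        by (simp add: zeta_trunc_def F_trunc_def dirichlet_term_def g_def f_def l1[simplified])
      thus ?thesis
        using order.strict_trans[OF gf, of \<epsilon>] \<epsilon> False by (simp only:) simp
    qed
  qed
qed

text \<open>Prepares the left half-plane: since \<open>G(s) G(\<delta> - s) = 1\<close>, this
  estimate at \<open>\<delta> - s\<close> says after reflection that
  \<open>\<zeta>\<^sub>N(s)\<close> exceeds \<open>M\<close> in norm. The leading term is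
  \<open>a 1\<close>, or, if that vanishes, the second term, which needs
  \<open>N \<ge> 2\<close>.\<close>

lemma zeta_trunc_dominates_G_factor:
  fixes a :: "nat \<Rightarrow> complex" and l :: "nat \<Rightarrow> real"
  assumes mono: "strict_mono_on {1..} l" and l1: "l 1 = 1" and a2: "a 2 \<noteq> 0"
    and growth: "\<exists>K::real. (\<lambda>n. norm (a n)) \<in> O(\<lambda>n. real n powr K)" "\<exists>K::real. l \<in> O(\<lambda>n. real n powr K)"
    and sm: "summable (\<lambda>n. norm (dirichlet_term a l (of_real \<sigma>) (Suc n)))"
    and G: "L > 0" "k \<ge> 1" "\<forall>i\<in>{1..k}. \<alpha> i > 0"
    and M: "M > 0"
  shows "eventually (\<lambda>(N, s). 2 \<le> N \<or> a 1 \<noteq> 0 \<longrightarrow>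
     M * norm (G_factor L \<delta> k \<alpha> \<beta> s) < norm (zeta_trunc a l L \<delta> k \<alpha> \<beta> N s)) far_right"
proof -
  \<comment> \<open>Half the leading coefficient: a lower bound for \<open>\<zeta>\<^sub>N\<close>
    if \<open>a 1 \<noteq> 0\<close>, and for \<open>\<zeta>\<^sub>N\<close> scaled by
    \<open>l 2 powr Re s\<close> otherwise.\<close>
  define m where "m = (if a 1 = 0 then norm (a 2) / 2 else norm (a 1) / 2)"
  have m: "m > 0" using a2 by (simp add: m_def)
  have l2: "1 < l 2"
    using strict_mono_onD[OF mono, of 1 2] l1 by auto
  define c where "c = norm (a 2) / 2"
  have c: "c > 0" using a2 by (simp add: c_def)
  have "eventually (\<lambda>(N, s). (1/2) powr Re s < m / M) far_right"
    using m M by (intro eventually_far_right_Re eventually_powr_less) auto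
  \<comment> \<open>The scaled distance from \<open>a 1\<close> will be below \<open>3 * c\<close>;
    the 6 brings the distance itself below \<open>norm (a 1) / 2\<close>.\<close>
  moreover have "eventually (\<lambda>(N, s). a 1 \<noteq> 0 \<longrightarrow> (1 / l 2) powr Re s < norm (a 1) / (6 * c)) far_right"
    using c l2 by (cases "a 1 = 0") (auto intro!: eventually_far_right_Re eventually_powr_less)
  moreover have "eventually (\<lambda>(N, s). 1 \<le> N \<and> 0 \<le> Re s) far_right"
    by (rule eventually_far_rightI[of 0 0]) auto
  moreover have "eventually (\<lambda>(N, s). norm (G_factor L \<delta> k \<alpha> \<beta> s) * (2 * l 2 * real N powr 0) powr Re s \<le> 1) far_right"
    using l2 by (intro G_factor_far_right[OF G]) auto
  moreover note zeta_trunc_far_right[where \<delta>=\<delta> and \<beta>=\<beta>, OF mono l1 growth sm G c]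
  ultimately show ?thesis
  proof (eventually_elim, clarify)
    fix N :: nat and s :: complex
    define g where "g = G_factor L \<delta> k \<alpha> \<beta> s"
    define z where "z = zeta_trunc a l L \<delta> k \<alpha> \<beta> N s"
    define p where "p = l 2 powr Re s"
    assume s: "(1/2) powr Re s < m / M" "a 1 \<noteq> 0 \<longrightarrow> (1 / l 2) powr Re s < norm (a 1) / (6 * c)" "1 \<le> N" "0 \<le> Re s"
      and g: "norm (G_factor L \<delta> k \<alpha> \<beta> s) * (2 * l 2 * real N powr 0) powr Re s \<le> 1"
      and z: "norm ((zeta_trunc a l L \<delta> k \<alpha> \<beta> N s - a 1) * of_real (l 2) powr s - (if 2 \<le> N then a 2 else 0)) < c"
      and N: "2 \<le> N \<or> a 1 \<noteq> 0"
    have nl2: "norm (of_real (l 2) powr s :: complex) = p"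
      using l2 by (simp add: norm_powr_real_powr p_def)
    have p: "1 \<le> p" using l2 s by (simp add: p_def ge_one_powr_ge_zero)
    have "norm g * p * 2 powr Re s \<le> 1"
      using g s l2 by (simp add: powr_mult p_def g_def mult_ac)
    hence "norm g * p \<le> (1/2) powr Re s"
      by (simp add: powr_divide field_simps)
    hence "norm g * p < m / M"
      using s(1) by simp
    hence gm: "M * norm g * p < m"
      using M by (simp add: field_simps)
    have "M * norm g < norm z"
    proof (cases "a 1 = 0")
      case True
      have "2 * c \<le> norm (z * of_real (l 2) powr s) + norm (z * of_real (l 2) powr s - a 2)"
        unfolding c_def by norm
      hence "c < norm z * p"
        using z True N by (simp add: norm_mult nl2 z_def)
      hence "M * norm g * p < norm z * p"
        using gm True by (simp add: m_def c_def)
      thus ?thesis using p by simp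
    next
      case False
      have "norm ((z - a 1) * of_real (l 2) powr s) \<le> norm ((z - a 1) * of_real (l 2) powr s - (if 2 \<le> N then a 2 else 0)) + 2 * c"
        unfolding c_def by (cases "2 \<le> N") (simp_all, norm)
      hence "norm (z - a 1) * p < 3 * c"
        using z by (simp add: norm_mult nl2 z_def)
      hence "norm (z - a 1) < 3 * c * (1 / l 2) powr Re s"
        using l2 by (simp add: powr_divide p_def field_simps)
      also have "\<dots> < norm (a 1) / 2"
        using s(2) False c by (simp add: field_simps)
      finally have "norm (a 1) / 2 < norm z"
        by norm
      moreover have "M * norm g * 1 \<le> M * norm g * p"
        using p M by (intro mult_left_mono) auto
      ultimately show ?thesis
        using gm False by (simp add: m_def)
    qed
    thus "M * norm (G_factor L \<delta> k \<alpha> \<beta> s) < norm (zeta_trunc a l L \<delta> k \<alpha> \<beta> N s)"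
      by (simp add: g_def z_def)
  qed
qed

section \<open>Assembly of the three claims\<close>

text \<open>The disjunctions exclude the degenerate case \<open>N = 1\<close>,
  \<open>a 1 = 0\<close>, where \<open>\<zeta>\<^sub>1\<close> vanishes identically, for those
  \<open>b\<close> at which the claim would fail. The ball around \<open>a 2\<close> requires
  \<open>N \<ge> 2\<close> because \<open>\<zeta>\<^sub>1\<close> contains no second term.\<close>

theorem theorem1p8:
  fixes a :: "nat \<Rightarrow> complex" and l :: "nat \<Rightarrow> real" and F :: "complex \<Rightarrow> complex"
    and L \<delta> :: real and k :: nat and \<alpha> \<beta> :: "nat \<Rightarrow> real"
  assumes "strict_mono_on {1..} l" and "l 1 = 1"
    and "a 2 \<noteq> 0" and "a 3 \<noteq> 0"
    and "\<exists>K::real. (\<lambda>n. norm (a n)) \<in> O(\<lambda>n. real n powr K)"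
    and "\<exists>K::real. l \<in> O(\<lambda>n. real n powr K)"
    and "is_dirichlet_series_function a l F"
    and "L > 0" and "k \<ge> 1" and "\<And>i. i \<in> {1..k} \<Longrightarrow> \<alpha> i > 0"
    and "functional_equation F L \<delta> k \<alpha> \<beta>"
  shows "\<exists>T\<^sub>0>0. \<forall>b::complex. \<exists>\<sigma>\<^sub>b>0. \<exists>\<gamma>>0. \<forall>N::nat. N \<ge> 1 \<longrightarrow>
    ((N \<ge> 2 \<or> a 1 \<noteq> 0 \<or> b \<noteq> 0) \<longrightarrow>
      (\<forall>s. Im s \<ge> T\<^sub>0 \<and> zeta_trunc a l L \<delta> k \<alpha> \<beta> N s - b = 0 \<longrightarrow>
         \<bar>Re s\<bar> < \<sigma>\<^sub>b * real N powr \<gamma>)) \<and>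
    (\<forall>s. Re s \<ge> \<sigma>\<^sub>b * real N powr \<gamma> \<and> Im s \<ge> T\<^sub>0 \<longrightarrow>
       (b \<noteq> a 1 \<longrightarrow>
          zeta_trunc a l L \<delta> k \<alpha> \<beta> N s - b \<in> ball (a 1 - b) (norm (a 1 - b) / 2)) \<and>
       (b = a 1 \<and> N \<ge> 2 \<longrightarrow>
          (zeta_trunc a l L \<delta> k \<alpha> \<beta> N s - b) * complex_of_real (l 2) powr s
            \<in> ball (a 2) (norm (a 2) / 2))) \<and>
    ((N \<ge> 2 \<or> a 1 \<noteq> 0 \<or> norm b > 1) \<longrightarrow>
      (\<forall>s. Re s \<le> - (\<sigma>\<^sub>b * real N powr \<gamma>) \<and> Im s \<ge> T\<^sub>0 \<longrightarrow>
         norm (zeta_trunc a l L \<delta> k \<alpha> \<beta> N s - b) > 1))"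
proof -
  obtain \<sigma>\<^sub>0 where \<sigma>\<^sub>0: "\<forall>s. Re s > \<sigma>\<^sub>0 \<longrightarrow>
      summable (\<lambda>n. norm (dirichlet_term a l s (Suc n))) \<and> (\<lambda>n. dirichlet_term a l s (Suc n)) sums F s"
    using assms(7) unfolding is_dirichlet_series_function_def by (elim conjE exE)
  have sm: "summable (\<lambda>n. norm (dirichlet_term a l (of_real (\<sigma>\<^sub>0 + 1)) (Suc n)))"
    using \<sigma>\<^sub>0[rule_format, of "of_real (\<sigma>\<^sub>0 + 1)"] by simp
  have \<alpha>: "\<forall>i\<in>{1..k}. \<alpha> i > 0"
    using assms(10) by blast
  have l2: "1 < l 2"
    using strict_mono_onD[OF assms(1), of 1 2] assms(2) by auto
  define Z where "Z = zeta_trunc a l L \<delta> k \<alpha> \<beta>"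
  define G where "G = G_factor L \<delta> k \<alpha> \<beta>"
  define W where "W s = (of_real (l 2) powr s :: complex)" for s
  have W: "1 \<le> norm (W s)" if "0 \<le> Re s" for s
    using that l2 by (simp add: W_def norm_powr_real_powr ge_one_powr_ge_zero)
  have reflect: "Z N s = G s * Z N (of_real \<delta> - s)" "G s * G (of_real \<delta> - s) = 1" if "Im s \<noteq> 0" for N s
    unfolding Z_def G_def
    using zeta_trunc_reflect[OF assms(8) \<alpha> that] G_factor_reflect[OF assms(8) \<alpha> that] by auto
  \<comment> \<open>One \<open>c\<close> serves as both coefficient and exponent, and the height is
    1 for every \<open>b\<close>, as in \<open>far_right\<close>.\<close>
  have main: "\<exists>c>0. \<forall>N\<ge>1.
     ((N \<ge> 2 \<or> a 1 \<noteq> 0 \<or> b \<noteq> 0) \<longrightarrow> (\<forall>s. Im s \<ge> 1 \<and> Z N s - b = 0 \<longrightarrow> \<bar>Re s\<bar> < c * real N powr c)) \<and>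
     (\<forall>s. Re s \<ge> c * real N powr c \<and> Im s \<ge> 1 \<longrightarrow>
       (b \<noteq> a 1 \<longrightarrow> Z N s - b \<in> ball (a 1 - b) (norm (a 1 - b) / 2)) \<and>
       (b = a 1 \<and> N \<ge> 2 \<longrightarrow> (Z N s - b) * W s \<in> ball (a 2) (norm (a 2) / 2))) \<and>
     ((N \<ge> 2 \<or> a 1 \<noteq> 0 \<or> norm b > 1) \<longrightarrow>
       (\<forall>s. Re s \<le> - (c * real N powr c) \<and> Im s \<ge> 1 \<longrightarrow> norm (Z N s - b) > 1))" for b
  proof -
    define d where "d = norm (a 1 - b) / 2"
    \<comment> \<open>\<open>norm (a 2)\<close> for the limit plus \<open>norm (a 2) / 2\<close> for
      the error.\<close>
    define C where "C = norm (a 2) * 3 / 2"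
    have C: "C > 0" using assms(3) by (simp add: C_def)
    have a2: "norm (a 2) / 2 > 0" using assms(3) by simp
    \<comment> \<open>With \<open>M = norm b + 1\<close>, reflection gives
      \<open>norm (Z N s) > norm b + 1\<close>, hence a distance from \<open>b\<close> above
      1.\<close>
    have M: "norm b + 1 > 0" by (simp add: add_nonneg_pos)
    have "eventually (\<lambda>(N, s). b \<noteq> a 1 \<longrightarrow> (1 / l 2) powr Re s < d / C) far_right"
      using C l2 by (cases "b = a 1") (auto simp: d_def intro!: eventually_far_right_Re eventually_powr_less)
    moreover note zeta_trunc_far_right[where \<delta>=\<delta> and \<beta>=\<beta>, OF assms(1,2,5,6) sm assms(8,9) \<alpha> a2]
    moreover note zeta_trunc_dominates_G_factor[where \<delta>=\<delta> and \<beta>=\<beta>, OF assms(1,2,3,5,6) sm assms(8,9) \<alpha> M]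
    ultimately have "eventually (\<lambda>(N, s).
        (b \<noteq> a 1 \<longrightarrow> norm (Z N s - a 1) < d) \<and>
        (2 \<le> N \<longrightarrow> norm ((Z N s - a 1) * W s - a 2) < norm (a 2) / 2) \<and>
        (2 \<le> N \<or> a 1 \<noteq> 0 \<longrightarrow> (norm b + 1) * norm (G s) < norm (Z N s))) far_right"
    proof (eventually_elim, unfold split_paired_all split_conv, fold Z_def G_def W_def, intro conjI)
      fix N s
      assume s: "b \<noteq> a 1 \<longrightarrow> (1 / l 2) powr Re s < d / C"
        and z: "norm ((Z N s - a 1) * W s - (if 2 \<le> N then a 2 else 0)) < norm (a 2) / 2"
        and g: "2 \<le> N \<or> a 1 \<noteq> 0 \<longrightarrow> (norm b + 1) * norm (G s) < norm (Z N s)"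
      show "2 \<le> N \<or> a 1 \<noteq> 0 \<longrightarrow> (norm b + 1) * norm (G s) < norm (Z N s)" by (fact g)
      show "2 \<le> N \<longrightarrow> norm ((Z N s - a 1) * W s - a 2) < norm (a 2) / 2"
        using z by (cases "2 \<le> N") simp_all
      show "b \<noteq> a 1 \<longrightarrow> norm (Z N s - a 1) < d"
      proof
        assume b: "b \<noteq> a 1"
        have "norm ((Z N s - a 1) * W s) \<le> norm ((Z N s - a 1) * W s - (if 2 \<le> N then a 2 else 0)) + norm (a 2)"
          by (cases "2 \<le> N") (simp_all, norm)
        hence "norm (Z N s - a 1) * norm (W s) < C"
          using z by (simp add: norm_mult C_def)
        hence "norm (Z N s - a 1) < C * (1 / l 2) powr Re s"
          using l2 by (simp add: powr_divide W_def norm_powr_real_powr field_simps)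
        also have "\<dots> < d"
          using s b C by (simp add: field_simps)
        finally show "norm (Z N s - a 1) < d" .
      qed
    qed
    then obtain c where c: "c > 0" and far:
      "\<And>N s. 1 \<le> N \<Longrightarrow> 1 \<le> \<bar>Im s\<bar> \<Longrightarrow> c * real N powr c \<le> Re s \<Longrightarrow>
        (b \<noteq> a 1 \<longrightarrow> norm (Z N s - a 1) < d) \<and>
        (2 \<le> N \<longrightarrow> norm ((Z N s - a 1) * W s - a 2) < norm (a 2) / 2) \<and>
        (2 \<le> N \<or> a 1 \<noteq> 0 \<longrightarrow> (norm b + 1) * norm (G s) < norm (Z N s))"
      unfolding eventually_far_right by auto
    \<comment> \<open>Leaves room for the shift by \<open>\<delta>\<close> when \<open>s\<close> is
      replaced by \<open>\<delta> - s\<close>.\<close>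
    define e where "e = c + \<bar>\<delta>\<bar>"
    have e: "c * real N powr c + \<bar>\<delta>\<bar> \<le> e * real N powr e" if "1 \<le> N" for N
    proof -
      have "c * real N powr c + \<bar>\<delta>\<bar> * 1 \<le> c * real N powr e + \<bar>\<delta>\<bar> * real N powr e"
        using that c by (intro add_mono mult_left_mono powr_mono ge_one_powr_ge_zero) (auto simp: e_def)
      thus ?thesis by (simp add: e_def algebra_simps)
    qed
    have Z1: "Z 1 s = 0" if "a 1 = 0" for s
      using that by (simp add: Z_def zeta_trunc_def F_trunc_def dirichlet_term_def)
    have right: "(b \<noteq> a 1 \<longrightarrow> Z N s - b \<in> ball (a 1 - b) (norm (a 1 - b) / 2)) \<and>
       (b = a 1 \<and> N \<ge> 2 \<longrightarrow> (Z N s - b) * W s \<in> ball (a 2) (norm (a 2) / 2))"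
      if "1 \<le> N" "e * real N powr e \<le> Re s" "1 \<le> Im s" for N s
      using far[of N s] e[of N] that by (auto simp: dist_norm norm_minus_commute d_def)
    have left: "norm (Z N s - b) > 1"
      if N: "1 \<le> N" "2 \<le> N \<or> a 1 \<noteq> 0 \<or> norm b > 1" and s: "Re s \<le> - (e * real N powr e)" "1 \<le> Im s" for N s
    proof (cases "2 \<le> N \<or> a 1 \<noteq> 0")
      case True
      have "(norm b + 1) * norm (G (of_real \<delta> - s)) < norm (Z N (of_real \<delta> - s))"
        using far[of N "of_real \<delta> - s"] e[of N] N s True by auto
      moreover have "norm (G s) > 0"
        using reflect(2)[of s] s by auto
      ultimately have "(norm b + 1) * norm (G s * G (of_real \<delta> - s)) < norm (G s * Z N (of_real \<delta> - s))"
        by (simp add: norm_mult mult.left_commute)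
      hence "norm b + 1 < norm (Z N s)"
        using reflect[of s] s by simp
      thus ?thesis by norm
    next
      case False
      hence "N = 1" "a 1 = 0" "norm b > 1" using N by auto
      thus ?thesis using Z1[of s] by simp
    qed
    \<comment> \<open>Follows from the other two claims, as neither ball contains 0; only
      \<open>N = 1\<close> with \<open>b = a 1 \<noteq> 0\<close> is not covered by them.\<close>
    have zeros: "\<bar>Re s\<bar> < e * real N powr e"
      if N: "1 \<le> N" "2 \<le> N \<or> a 1 \<noteq> 0 \<or> b \<noteq> 0" and s: "1 \<le> Im s" "Z N s - b = 0" for N s
    proof (rule ccontr)
      assume "\<not> \<bar>Re s\<bar> < e * real N powr e"
      hence "e * real N powr e \<le> Re s \<or> Re s \<le> - (e * real N powr e)" by linarith
      thus False
      proof
        assume re: "e * real N powr e \<le> Re s"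
        have "Z N s = b" using s by simp
        show False
        proof (cases "b = a 1")
          case False
          thus False using right[OF N(1) re s(1)] \<open>Z N s = b\<close> by (auto simp: dist_norm)
        next
          case True
          show False
          proof (cases "2 \<le> N")
            case True
            thus False using right[OF N(1) re s(1)] \<open>Z N s = b\<close> \<open>b = a 1\<close> assms(3) by (auto simp: dist_norm)
          next
            case False
            \<comment> \<open>Here \<open>\<zeta>\<^sub>1(s) = a\<^sub>1 (1 + G(s))\<close>, so the
              value \<open>a 1\<close> would force \<open>G s = 0\<close>, against the reflection
              identity.\<close>
            hence "N = 1" "a 1 \<noteq> 0" using N True by auto
            moreover have "Z 1 s = a 1 + G s * a 1"
              using assms(2) by (simp add: Z_def G_def zeta_trunc_def F_trunc_def dirichlet_term_def)
            ultimately have "G s = 0" using \<open>Z N s = b\<close> True by simp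
            thus False using reflect(2)[of s] s by simp
          qed
        qed
      next
        assume re: "Re s \<le> - (e * real N powr e)"
        show False
        proof (cases "2 \<le> N \<or> a 1 \<noteq> 0")
          case True
          thus False using left[OF N(1) _ re s(1)] s(2) by auto
        next
          case False
          hence "N = 1" "a 1 = 0" "b \<noteq> 0" using N by auto
          thus False using Z1[of s] s(2) by simp
        qed
      qed
    qed
    show ?thesis
      using c right left zeros by (intro exI[of _ e] conjI allI impI) (auto simp: e_def)
  qed
  show ?thesis
    using main unfolding Z_def W_def by (intro exI[of _ 1]) (rule conjI[OF zero_less_one], rule allI, blast)
qed

end
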